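(* Let $q=p^e$ be a prime power, $n$ a positive integer coprime to $q$, and $n'=p_1^{j_1}\cdots p_s^{j_s}$, where $p_1<\cdots<p_s$ are prime numbers different from $p$ and not dividing $n$, and $j_1,\dots,j_s$ are positive integers. Let $\gamma\in\mathbb{Z}$ and $\tau=|c_n(\gamma)|$. Then for every $I=(\mathfrak{m},\mathfrak{a},\mathfrak{t})\in\mathcal{I}_{nn'/n}(\gamma)$, the size of the $q$-cyclotomic coset $c_{nn'}(\gamma_I)$ is $$|c_{nn'}(\gamma_I)|=\tau_s(\mathfrak{m}).$$
   Context: Notation: $\mathbb{N}=\{0,1,\dots\}$; $[a,b]$ is the set of integers from $a$ to $b$; $v_\ell$ is the $\ell$-adic valuation; $\overline{[0,j_k-1]}=[0,j_k-1]\cup\{\infty\}$. For $M\geq1$ coprime to $q$, the $q$-cyclotomic coset modulo $M$ containing $\gamma$ is $c_M(\gamma)=\{\gamma,\gamma q,\dots,\gamma q^{\tau-1}\}\subseteq\mathbb{Z}/M\mathbb{Z}$, where $\tau$ is the least positive integer with $\gamma q^\tau\equiv\gamma\pmod M$; its size is $|c_M(\gamma)|=\tau$. Sizes. For $\mathfrak{m}=(m_1,\dots,m_s)$ with $m_k\in\overline{[0,j_k-1]}$, write $\mathfrak{m}_{\leq k}=(m_1,\dots,m_k)$ and define recursively: $\bullet$ $k=1$: $r_1=[(\mathbb{Z}/p_1\mathbb{Z})^*:\langle q^\tau\rangle]$; $v_1=v_2(q^\tau+1)$ if $p_1=2$ and $q^\tau\equiv3\pmod4$, and $v_1=v_{p_1}(q^{\tau(p_1-1)/r_1}-1)$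 otherwise. If $p_1=2$ and $q^\tau\equiv3\pmod 4$: $\tau_1(\mathfrak{m}_{\leq1})=\tau$ if $m_1\in\{j_1-1,\infty\}$ and $\tau_1(\mathfrak{m}_{\leq1})=2^{\max\{1,j_1-m_1-v_1\}}\tau$ if $0\leq m_1\leq j_1-2$. Otherwise: $\tau_1(\mathfrak{m}_{\leq1})=\tau$ if $m_1=\infty$ and $\tau_1(\mathfrak{m}_{\leq1})=p_1^{\max\{0,j_1-m_1-v_1\}}\frac{p_1-1}{r_1}\tau$ if $0\leq m_1\leq j_1-1$. $\bullet$ $2\leq k\leq s$: $r_k(\mathfrak{m}_{\leq k-1})=[(\mathbb{Z}/p_k\mathbb{Z})^*:\langle q^{\tau_{k-1}(\mathfrak{m}_{\leq k-1})}\rangle]$, $\widetilde\tau_k=\frac{\tau_{k-1}(\mathfrak{m}_{\leq k-1})(p_k-1)}{r_k(\mathfrak{m}_{\leq k-1})}$, $v_k(\mathfrak{m}_{\leq k-1})=v_{p_k}(q^{\widetilde\tau_k}-1)$; $\tau_k(\mathfrak{m}_{\leq k})=\tau_{k-1}(\mathfrak{m}_{\leq k-1})$ if $m_k=\infty$, and $\tau_k(\mathfrak{m}_{\leq k})=p_k^{\max\{0,j_k-m_k-v_k(\mathfrak{m}_{\leq k-1})\}}\frac{p_k-1}{r_k(\mathfrak{m}_{\leq k-1})}\tau_{k-1}(\mathfrak{m}_{\leq k-1})$ if $0\leq m_k\leq j_k-1$. Index set. $\mathcal{I}_{nn'/n}(\gamma)$ is the set of triples $(\mathfrak{m},\mathfrak{a},\mathfrak{t})$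 with $\mathfrak{m}\in\overline{[0,j_1-1]}\times\cdots\times\overline{[0,j_s-1]}$ and $\mathfrak{a},\mathfrak{t}\in\mathbb{N}^s$ such that: (i) for every $k$, if $m_k=\infty$ then $a_k=t_k=0$; (ii) if $m_1\in[0,j_1-1]$: when $p_1=2$ and $q^\tau\equiv3\pmod4$, $a_1=1$ and $t_1\in[0,2^{\max\{0,\min\{v_1-1,j_1-m_1-2\}\}}-1]$; otherwise $a_1\in[1,r_1]$ and $t_1\in[0,p_1^{\min\{v_1,j_1-m_1\}-1}-1]$; (iii) for $2\leq k\leq s$, if $m_k\in[0,j_k-1]$ then $a_k\in[1,r_k(\mathfrak{m}_{\leq k-1})]$ and $t_k\in[0,p_k^{\min\{v_k(\mathfrak{m}_{\leq k-1}),j_k-m_k\}-1}-1]$. The integers $\varphi$ and $U$. For a positive integer $B$, a prime $\ell\nmid B$, $\ell\ne p$, and $\delta\in\mathbb{Z}$, let $\varphi_B^\ell(\delta)=-\delta/B=\sum_{k\geq0}\phi_k\ell^k\in\mathbb{Z}_\ell$ ($\phi_k\in[0,\ell-1]$) and $\varphi_B^\ell(\delta)_{\leq i}=\sum_{k=0}^i\phi_k\ell^k$. Let $\theta$ be the size of $c_B(\delta)$ and $r=[(\mathbb{Z}/\ell\mathbb{Z})^*:\langle q^\theta\rangle]$. For $m\in\mathbb{N}$, $a\in[1,r]$, put $U_B^\ell(\delta;m,a)=\sum_{k=0}^{m-1}\phi_k\ell^k+u\,\ell^m$, where: if $\ell\mid q^\theta-1$ (so $r=\ell-1$), $u=\sigma^m_a$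 with $[0,\ell-1]\setminus\{\phi_m\}=\{\sigma_1^m<\cdots<\sigma_{\ell-1}^m\}$; if $\ell\nmid q^\theta-1$, $u\in[0,\ell-1]$ with $u\equiv\phi_m+\sigma_a\pmod\ell$, where $\{\sigma_1<\dots<\sigma_r\}\subseteq[1,\ell-1]$ is a fixed full set of representatives of $(\mathbb{Z}/\ell\mathbb{Z})^*/\langle q^\theta\rangle$. For $\ell=2$ write $U_B^2(\delta;m)=U_B^2(\delta;m,1)=\sum_{k<m}\phi_k2^k+(1-\phi_m)2^m$. The representative $\gamma_I$. For $I=(\mathfrak{m},\mathfrak{a},\mathfrak{t})$ put $\gamma_I=\gamma_{I,s}$, where: $\bullet$ $\gamma_{I,1}=\gamma+n\cdot\varphi_n^{p_1}(\gamma)_{\leq j_1-1}$ if $m_1=\infty$; $\gamma_{I,1}=\gamma+n(U_n^2(\gamma;m_1)+2^{m_1+2}t_1)$ if $0\leq m_1\leq j_1-1$, $p_1=2$ and $q^\tau\equiv3\pmod4$; $\gamma_{I,1}=\gamma+n(U_n^{p_1}(\gamma;m_1,a_1)+p_1^{m_1+1}t_1)$ otherwise. $\bullet$ For $2\leq k\leq s$, with $B_k=p_1^{j_1}\cdots p_{k-1}^{j_{k-1}}n$: $\gamma_{I,k}=\gamma_{I,k-1}+B_k\,\varphi_{B_k}^{p_k}(\gamma_{I,k-1})_{\leq j_k-1}$ if $m_k=\infty$; $\gamma_{I,k}=\gamma_{I,k-1}+B_k\bigl(U_{B_k}^{p_k}(\gamma_{I,k-1};m_k,a_k)+p_k^{m_k+1}t_k\bigr)$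 if $0\leq m_k\leq j_k-1$. (Here the size $\theta$ of $c_{B_k}(\gamma_{I,k-1})$ used in forming $U$ is $\tau_{k-1}(\mathfrak{m}_{\leq k-1})$.) *)

theory Defs
  imports
    "HOL-Library.FuncSet"
    "HOL-Library.Extended_Nat"
    "HOL-Algebra.Generated_Groups"
    "HOL-Number_Theory.Number_Theory"
begin

text \<open>Elements of \<open>\<int>/M\<int>\<close> are represented by their least nonnegative residues.\<close>

definition coset_period :: "nat \<Rightarrow> nat \<Rightarrow> int \<Rightarrow> nat" where
  "coset_period q M \<gamma> = (LEAST t. 0 < t \<and> [\<gamma> * int q ^ t = \<gamma>] (mod int M))"

definition cyc_coset :: "nat \<Rightarrow> nat \<Rightarrow> int \<Rightarrow> int set" where
  "cyc_coset q M \<gamma> = (\<lambda>i. (\<gamma> * int q ^ i) mod int M) ` {0..<coset_period q M \<gamma>}"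

abbreviation units_mod :: "nat \<Rightarrow> int monoid" where
  "units_mod l \<equiv> units_of (residue_ring (int l))"

definition power_subgroup :: "nat \<Rightarrow> nat \<Rightarrow> int set" where
  "power_subgroup l x = generate (units_mod l) {int x mod int l}"

definition unit_index :: "nat \<Rightarrow> nat \<Rightarrow> nat" where
  "unit_index l x = card (rcosets\<^bsub>units_mod l\<^esub> power_subgroup l x)"

definition full_reps :: "nat \<Rightarrow> nat \<Rightarrow> nat set \<Rightarrow> bool" where
  "full_reps l x R \<longleftrightarrow>
     R \<subseteq> {1..l - 1} \<and>
     (\<forall>C \<in> rcosets\<^bsub>units_mod l\<^esub> power_subgroup l x. \<exists>!u. u \<in> R \<and> int u \<in> C)"

text \<open>
  In the following, sequences indexed by \<open>1, \<dots>, s\<close> are functions on \<open>nat\<close>: the primes \<open>P k\<close>, the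
  exponents \<open>j k\<close>, and the components \<open>m k\<close>, \<open>a k\<close>, \<open>t k\<close> of a triple.

  \<open>rk\<close> and \<open>vk\<close> are \<open>r\<^sub>k\<close> and \<open>v\<^sub>k\<close> as functions of \<open>l = p\<^sub>k\<close> and \<open>t = \<tau>\<^bsub>k-1\<^esub>\<close>. With
  \<open>\<tau>\<^sub>0 = \<tau>\<close> they also give \<open>r\<^sub>1\<close> and, outside the exceptional case, \<open>v\<^sub>1\<close>. The divisions are exact,
  since \<open>r\<^sub>k\<close> divides \<open>p\<^sub>k - 1\<close>. Truncated subtraction on \<open>nat\<close> renders the operation
  \<open>max {0, \<dots>}\<close> wherever it occurs in the formulas below.
\<close>

definition rk :: "nat \<Rightarrow> nat \<Rightarrow> nat \<Rightarrow> nat" where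
  "rk q l t = unit_index l (q ^ t)"

definition vk :: "nat \<Rightarrow> nat \<Rightarrow> nat \<Rightarrow> nat" where
  "vk q l t = multiplicity l (q ^ (t * (l - 1) div rk q l t) - 1)"

definition exceptional :: "nat \<Rightarrow> nat \<Rightarrow> (nat \<Rightarrow> nat) \<Rightarrow> bool" where
  "exceptional q \<tau> P \<longleftrightarrow> P 1 = 2 \<and> [q ^ \<tau> = 3] (mod 4)"

definition v1_exc :: "nat \<Rightarrow> nat \<Rightarrow> nat" where
  "v1_exc q \<tau> = multiplicity 2 (q ^ \<tau> + 1)"

primrec tau ::
  "nat \<Rightarrow> nat \<Rightarrow> (nat \<Rightarrow> nat) \<Rightarrow> (nat \<Rightarrow> nat) \<Rightarrow> (nat \<Rightarrow> enat) \<Rightarrow> nat \<Rightarrow> nat" where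
  "tau q \<tau> P j m 0 = \<tau>"
| "tau q \<tau> P j m (Suc k) =
    (let l = P (Suc k); J = j (Suc k); t = tau q \<tau> P j m k in
      case m (Suc k) of
        \<infinity> \<Rightarrow> t
      | enat i \<Rightarrow>
          if k = 0 \<and> exceptional q \<tau> P
          then (if i = J - 1 then \<tau> else 2 ^ max 1 (J - i - v1_exc q \<tau>) * \<tau>)
          else l ^ (J - i - vk q l t) * ((l - 1) div rk q l t) * t)"

text \<open>The tuples are extensional functions, so that each triple is represented exactly once.\<close>

definition index_set ::
  "nat \<Rightarrow> nat \<Rightarrow> int \<Rightarrow> nat \<Rightarrow> (nat \<Rightarrow> nat) \<Rightarrow> (nat \<Rightarrow> nat)
    \<Rightarrow> ((nat \<Rightarrow> enat) \<times> (nat \<Rightarrow> nat) \<times> (nat \<Rightarrow> nat)) set" where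
  "index_set q n \<gamma> s P j =
    {(m, a, t).
      m \<in> (\<Pi>\<^sub>E k\<in>{1..s}. enat ` {0..j k - 1} \<union> {\<infinity>}) \<and>
      a \<in> {1..s} \<rightarrow>\<^sub>E UNIV \<and>
      t \<in> {1..s} \<rightarrow>\<^sub>E UNIV \<and>
      (\<forall>k\<in>{1..s}.
        let \<tau> = card (cyc_coset q n \<gamma>); l = P k; \<tau>' = tau q \<tau> P j m (k - 1) in
        case m k of
          \<infinity> \<Rightarrow> a k = 0 \<and> t k = 0
        | enat i \<Rightarrow>
            if k = 1 \<and> exceptional q \<tau> P
            then a k = 1 \<and> t k \<in> {0..2 ^ min (v1_exc q \<tau> - 1) (j k - i - 2) - 1}
            else a k \<in> {1..rk q l \<tau>'} \<and>
                 t k \<in> {0..l ^ (min (vk q l \<tau>') (j k - i) - 1) - 1})}"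

text \<open>
  The digits \<open>\<phi>\<^sub>0, \<phi>\<^sub>1, \<dots>\<close> of \<open>-\<delta>/B \<in> \<int>\<^sub>l\<close>. The equation \<open>B \<cdot> (\<Sum>k. \<phi>\<^sub>k l\<^sup>k) = -\<delta>\<close> in
  \<open>\<int>\<^sub>l = lim \<int>/l\<^sup>i\<int>\<close> says that it holds modulo every power of \<open>l\<close>; as \<open>l\<close> does not divide \<open>B\<close>,
  it has exactly one solution with all digits below \<open>l\<close>.
\<close>

definition phi_digit :: "nat \<Rightarrow> nat \<Rightarrow> int \<Rightarrow> nat \<Rightarrow> nat" where
  "phi_digit B l \<delta> =
    (THE \<phi>. (\<forall>k. \<phi> k < l) \<and>
            (\<forall>i. [int B * int (\<Sum>k<i. \<phi> k * l ^ k) = - \<delta>] (mod int l ^ i)))"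

definition phi_trunc :: "nat \<Rightarrow> nat \<Rightarrow> int \<Rightarrow> nat \<Rightarrow> nat" where
  "phi_trunc B l \<delta> i = (\<Sum>k\<le>i. phi_digit B l \<delta> k * l ^ k)"

text \<open>
  \<open>R B l \<delta>\<close> is the chosen set of representatives \<open>{\<sigma>\<^sub>1 < \<dots> < \<sigma>\<^sub>r}\<close> of
  \<open>(\<int>/l\<int>)\<^sup>*/\<langle>q\<^sup>\<theta>\<rangle>\<close>, where \<open>\<theta>\<close> is the size of the coset of \<open>\<delta>\<close> modulo \<open>B\<close>. Positions in
  sorted lists are counted from \<open>0\<close>, hence the index \<open>a - 1\<close>.
\<close>

definition U ::
  "nat \<Rightarrow> (nat \<Rightarrow> nat \<Rightarrow> int \<Rightarrow> nat set) \<Rightarrow> nat \<Rightarrow> nat \<Rightarrow> int \<Rightarrow> nat \<Rightarrow> nat \<Rightarrow> nat" where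
  "U q R B l \<delta> m a =
    (let \<theta> = card (cyc_coset q B \<delta>);
         \<phi> = phi_digit B l \<delta>;
         u = (if l dvd q ^ \<theta> - 1
              then sorted_list_of_set ({0..l - 1} - {\<phi> m}) ! (a - 1)
              else (\<phi> m + sorted_list_of_set (R B l \<delta>) ! (a - 1)) mod l)
     in (\<Sum>k<m. \<phi> k * l ^ k) + u * l ^ m)"

definition Bk :: "nat \<Rightarrow> (nat \<Rightarrow> nat) \<Rightarrow> (nat \<Rightarrow> nat) \<Rightarrow> nat \<Rightarrow> nat" where
  "Bk n P j k = (\<Prod>i\<in>{1..<k}. P i ^ j i) * n"

text \<open>\<open>\<gamma>\<^bsub>I,k\<^esub>\<close>, with \<open>\<gamma>\<^bsub>I,0\<^esub> = \<gamma>\<close> and \<open>B\<^sub>1 = n\<close>.\<close>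

primrec gamma_rep ::
  "nat \<Rightarrow> (nat \<Rightarrow> nat \<Rightarrow> int \<Rightarrow> nat set) \<Rightarrow> nat \<Rightarrow> int \<Rightarrow> (nat \<Rightarrow> nat) \<Rightarrow> (nat \<Rightarrow> nat)
    \<Rightarrow> (nat \<Rightarrow> enat) \<Rightarrow> (nat \<Rightarrow> nat) \<Rightarrow> (nat \<Rightarrow> nat) \<Rightarrow> nat \<Rightarrow> int" where
  "gamma_rep q R n \<gamma> P j m a t 0 = \<gamma>"
| "gamma_rep q R n \<gamma> P j m a t (Suc k) =
    (let l = P (Suc k); B = Bk n P j (Suc k); g = gamma_rep q R n \<gamma> P j m a t k in
      case m (Suc k) of
        \<infinity> \<Rightarrow> g + int (B * phi_trunc B l g (j (Suc k) - 1))
      | enat i \<Rightarrow>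
          if k = 0 \<and> exceptional q (card (cyc_coset q n \<gamma>)) P
          then g + int (B * (U q R B 2 g i 1 + 2 ^ (i + 2) * t (Suc k)))
          else g + int (B * (U q R B l g i (a (Suc k)) + l ^ (i + 1) * t (Suc k))))"

end

theory Submission
  imports Defs
begin

text \<open>
  The size of \<open>c\<^sub>M(\<gamma>)\<close> is the order of \<open>q\<close> modulo \<open>M / gcd(M, \<gamma>)\<close>. Let \<open>g' \<equiv> g (mod B)\<close>, let \<open>\<theta>\<close>
  be the size of \<open>c\<^sub>B(g)\<close>, and let \<open>l\<close> be a prime not dividing \<open>B\<close>. Then \<open>c(g')\<close> modulo \<open>B l\<^sup>J\<close> has
  \<open>\<theta>\<close> times as many elements as the order of \<open>q\<^sup>\<theta>\<close> modulo \<open>l\<^bsup>J-i\<^esup>\<close>, where \<open>i = min {v\<^sub>l(g'), J}\<close>.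
  The representative \<open>\<gamma>\<^bsub>I,k\<^esub>\<close> is \<open>\<gamma>\<^bsub>I,k-1\<^esub> + B x\<close>, where \<open>x\<close> agrees with the \<open>l\<close>-adic integer
  \<open>-\<gamma>\<^bsub>I,k-1\<^esub>/B\<close> in exactly the first \<open>m\<^sub>k\<close> digits (in the first \<open>j\<^sub>k\<close> digits if \<open>m\<^sub>k = \<infinity>\<close>), so that
  \<open>i = m\<^sub>k\<close> (or \<open>i = j\<^sub>k\<close>). Orders modulo prime powers come from lifting the exponent; since the
  primes increase, \<open>l = 2\<close> can only occur at the first step.
\<close>

section \<open>Orders modulo prime powers\<close>

lemma Suc_power_eq_geometric: "(y + 1) ^ n = 1 + y * (\<Sum>i<n. (y + 1) ^ i)" for y :: nat
  by (induction n) (auto simp: algebra_simps)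

text \<open>Binomial expansion to first order: all later terms contain \<open>y ^ 2\<close>, which
  \<open>d ^ 2\<close> divides.\<close>

lemma Suc_power_cong_linear:
  fixes y d :: nat
  assumes "d dvd y"
  shows "[(y + 1) ^ i = 1 + i * y] (mod d ^ 2)"
proof (induction i)
  case (Suc i)
  have "[(y + 1) ^ Suc i = (y + 1) * (1 + i * y)] (mod d ^ 2)"
    using Suc by (simp add: cong_scalar_left del: add_Suc_right add_Suc)
  also have "(y + 1) * (1 + i * y) = (1 + Suc i * y) + i * y ^ 2"
    by (simp add: algebra_simps power2_eq_square)
  also have "[\<dots> = (1 + Suc i * y) + 0] (mod d ^ 2)"
    using assms by (intro cong_add) (auto simp: cong_0_iff)
  finally show ?case by simp
qed auto

text \<open>For an odd prime this removes the linear term of the geometric sum modulo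
  \<open>l ^ 2\<close>, because \<open>y\<close> supplies the second factor
  \<open>l\<close>.\<close>

lemma sum_lessThan_id_dvd:
  fixes l :: nat
  assumes "odd l"
  shows "l dvd (\<Sum>i<l. i)"
proof -
  have "2 * (\<Sum>i<l. i) = l * (l - 1)"
    by (induction l) (auto simp: algebra_simps)
  moreover have "coprime l 2" using assms by simp
  ultimately show ?thesis
    by (metis coprime_dvd_mult_right_iff dvd_triv_left)
qed

text \<open>Factor \<open>x ^ n - 1\<close> as \<open>(x - 1) * S n\<close>, with \<open>S n\<close>
  the geometric sum. If \<open>l\<close> does not divide \<open>n\<close>, then \<open>S n\<close>
  is congruent to \<open>n\<close> modulo \<open>l\<close> and contributes nothing. Otherwise one
  factor \<open>l\<close> is split off: \<open>S l\<close> contains \<open>l\<close> exactly once,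
  and induction applies to \<open>x ^ l\<close> and \<open>n div l\<close>. At \<open>l = 2\<close>
  the sum is \<open>x + 1\<close>, and divisibility of \<open>x - 1\<close> by 4 keeps it from being
  a multiple of 4.\<close>

lemma multiplicity_power_minus_one:
  fixes l x n :: nat
  assumes l: "prime l" and x: "x > 1" "l dvd x - 1" "l = 2 \<Longrightarrow> 4 dvd x - 1" and "n > 0"
  shows "multiplicity l (x ^ n - 1) = multiplicity l (x - 1) + multiplicity l n"
  using \<open>n > 0\<close> x
proof (induction n arbitrary: x rule: less_induct)
  case (less n)
  define y where "y = x - 1"
  have y: "x = y + 1" "y > 0" "l dvd y" "l = 2 \<Longrightarrow> 4 dvd y"
    using less.prems by (auto simp: y_def)
  define S where "S = (\<lambda>n. \<Sum>i<n. (y + 1) ^ i)"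
  have fac: "x ^ n - 1 = (x - 1) * S n" for n
    unfolding y(1) S_def using Suc_power_eq_geometric[of y n] by simp
  have pe: "prime_elem l" using l by simp
  have S_pos: "S n > 0" if "n > 0" for n
    unfolding S_def using that by (intro sum_pos) auto
  have mult: "multiplicity l (x ^ n - 1) = multiplicity l (x - 1) + multiplicity l (S n)"
    if "n > 0" for n
    unfolding fac using S_pos[OF that] y
    by (intro prime_elem_multiplicity_mult_distrib pe) auto
  show ?case
  proof (cases "l dvd n")
    case False
    have "[S n = (\<Sum>i<n. 1)] (mod l)"
      unfolding S_def
    proof (intro cong_sum)
      fix i
      have "[y + 1 = 0 + 1] (mod l)" using y(3) by (intro cong_add) (auto simp: cong_0_iff)
      from cong_pow[OF this, of i] show "[(y + 1) ^ i = 1] (mod l)" by simp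
    qed
    hence "\<not> l dvd S n" using False by (simp add: cong_dvd_iff)
    thus ?thesis using mult[of n] less.prems False by (simp add: not_dvd_imp_multiplicity_0)
  next
    case True
    then obtain n' where n': "n = l * n'" by auto
    have n'_pos: "n' > 0" using less.prems n' by auto
    have l1: "l > 1" using l prime_gt_1_nat by blast
    have "n' < n" using n' n'_pos l1 by simp
    have "[S l = l] (mod l ^ 2)"
    proof (cases "l = 2")
      case True
      with y(4) obtain c where "y = 4 * c" by auto
      hence "S l = 2 + 4 * c" using True by (simp add: S_def numeral_2_eq_2)
      moreover have "(2 + 4 * c) mod 4 = 2" by presburger
      ultimately show ?thesis using True by (simp add: cong_def)
    next
      case False
      hence "odd l" using l prime_odd_nat[of l] prime_ge_2_nat[of l] by force
      have "[S l = (\<Sum>i<l. 1 + i * y)] (mod l ^ 2)"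
        unfolding S_def using y(3) by (intro cong_sum Suc_power_cong_linear) auto
      also have "(\<Sum>i<l. 1 + i * y) = l + (\<Sum>i<l. i) * y"
        by (simp only: sum.distrib sum_distrib_right) simp
      also have "[\<dots> = l + 0] (mod l ^ 2)"
        using sum_lessThan_id_dvd[OF \<open>odd l\<close>] y(3)
        by (intro cong_add) (auto simp: cong_0_iff power2_eq_square intro: mult_dvd_mono)
      finally show ?thesis by simp
    qed
    \<comment> \<open>Being congruent modulo \<open>l ^ 2\<close>, the numbers \<open>S l\<close>
      and \<open>l\<close> are divisible by the same powers of \<open>l\<close> up to the
      second.\<close>
    hence dvd: "d dvd S l \<longleftrightarrow> d dvd l" if "d dvd l ^ 2" for d
      using that cong_dvd_iff cong_dvd_modulus_nat by blast
    have "multiplicity l (S l) = 1"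
    proof (rule multiplicity_eqI)
      show "l ^ 1 dvd S l" using dvd[of l] by simp
      show "\<not> l ^ Suc 1 dvd S l"
        using dvd[of "l ^ 2"] l1 by (auto simp: power2_eq_square dest: dvd_imp_le)
    qed
    hence ml: "multiplicity l (x ^ l - 1) = multiplicity l (x - 1) + 1"
      using mult[of l] l1 by simp
    have "x ^ l > 1" using less.prems(2) l1 by (intro one_less_power) auto
    moreover have "l dvd x ^ l - 1" "l = 2 \<Longrightarrow> 4 dvd x ^ l - 1"
      using less.prems(3,4) fac[of l] by auto
    ultimately have "multiplicity l ((x ^ l) ^ n' - 1) = multiplicity l (x ^ l - 1) + multiplicity l n'"
      using less.IH[of n' "x ^ l"] \<open>n' < n\<close> n'_pos by blast
    moreover have "multiplicity l n = Suc (multiplicity l n')"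
      using n' n'_pos l by (simp add: prime_elem_multiplicity_mult_distrib)
    ultimately show ?thesis
      using ml by (simp add: n' power_mult)
  qed
qed

section \<open>Orders read off from multiplicities\<close>

lemma cong_1_iff_dvd_minus_1:
  fixes x d :: nat
  assumes "x \<ge> 1"
  shows "[x = 1] (mod d) \<longleftrightarrow> d dvd x - 1"
  using cong_altdef_nat[OF assms] by simp

text \<open>Orders and coset sizes are identified through their multiples, which are exponents
  satisfying a congruence. Restricting to \<open>u > 0\<close> keeps \<open>Q ^ u - 1\<close>
  nonzero where its multiplicity is taken.\<close>

lemma nat_dvd_eqI:
  fixes a b :: nat
  assumes "a > 0" "b > 0" "\<And>u. u > 0 \<Longrightarrow> a dvd u \<longleftrightarrow> b dvd u"
  shows "a = b"
  using assms by (meson dvd_antisym dvd_refl)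

text \<open>An exponent that works modulo \<open>l ^ w\<close> works modulo \<open>l\<close>, so it
  is \<open>f * c\<close>. Lifting the exponent from \<open>Q ^ f\<close> shows that
  \<open>l\<close> occurs in \<open>Q ^ (f * c) - 1\<close> exactly
  \<open>v + multiplicity l c\<close> times, so \<open>c\<close> must supply the missing
  \<open>w - v\<close> factors, none if \<open>w \<le> v\<close>.\<close>

lemma ord_prime_power:
  fixes l Q w :: nat
  assumes l: "prime l" and Q: "Q > 1" "\<not> l dvd Q" "l = 2 \<Longrightarrow> [Q = 1] (mod 4)" and w: "w \<ge> 1"
  defines "f \<equiv> ord l Q"
  defines "v \<equiv> multiplicity l (Q ^ f - 1)"
  shows "ord (l ^ w) Q = f * l ^ (w - v)"
proof (rule nat_dvd_eqI)
  have cop: "coprime l Q" using l Q(2) prime_imp_coprime by blast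
  thus "ord (l ^ w) Q > 0" by simp
  have f: "f > 0" using cop by (simp add: f_def)
  show "f * l ^ (w - v) > 0" using f l prime_gt_0_nat by simp
  fix u :: nat assume u: "u > 0"
  have one: "Q ^ k \<ge> 1" for k using Q(1) by simp
  show "ord (l ^ w) Q dvd u \<longleftrightarrow> f * l ^ (w - v) dvd u"
  proof (cases "f dvd u")
    case False
    have "\<not> ord (l ^ w) Q dvd u"
    proof
      assume "ord (l ^ w) Q dvd u"
      hence "[Q ^ u = 1] (mod l ^ w)" using ord_divides by blast
      hence "[Q ^ u = 1] (mod l)" using w
        by (meson cong_dvd_modulus_nat dvd_power less_le_trans zero_less_one)
      thus False using False ord_divides unfolding f_def by blast
    qed
    thus ?thesis using False dvd_mult_left by blast
  next
    case True
    then obtain c where c: "u = f * c" by auto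
    have c0: "c > 0" using c u by auto
    have Qf: "Q ^ f > 1" using Q(1) f by (rule one_less_power)
    have dvd: "l dvd Q ^ f - 1"
      using ord[of Q l] cong_1_iff_dvd_minus_1[OF one] unfolding f_def by blast
    have dvd4: "4 dvd Q ^ f - 1" if "l = 2"
      using cong_pow[OF Q(3)[OF that], of f] cong_1_iff_dvd_minus_1[OF one] by (metis power_one)
    have m: "multiplicity l (Q ^ u - 1) = v + multiplicity l c"
      using multiplicity_power_minus_one[OF l Qf dvd dvd4 c0] by (simp add: c power_mult v_def)
    have "Q ^ u > 1" using Q(1) u by (rule one_less_power)
    have nu: "\<not> is_unit l" using l by (simp add: prime_nat_iff)
    have "ord (l ^ w) Q dvd u \<longleftrightarrow> l ^ w dvd Q ^ u - 1"
      using cong_1_iff_dvd_minus_1[OF one] ord_divides[of Q u "l ^ w"] by blast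
    also have "\<dots> \<longleftrightarrow> w \<le> v + multiplicity l c"
      unfolding m[symmetric] using \<open>Q ^ u > 1\<close> nu by (intro power_dvd_iff_le_multiplicity) auto
    also have "\<dots> \<longleftrightarrow> w - v \<le> multiplicity l c" by auto
    also have "\<dots> \<longleftrightarrow> l ^ (w - v) dvd c"
      using c0 nu power_dvd_iff_le_multiplicity[of c l "w - v"] by simp
    also have "\<dots> \<longleftrightarrow> f * l ^ (w - v) dvd u" using f by (simp add: c)
    finally show ?thesis .
  qed
qed

text \<open>For \<open>Q \<equiv> 3 (mod 4)\<close> the order modulo 4 is 2, and the previous lemma applies to \<open>Q\<^sup>2\<close>.\<close>

lemma ord_two_power_3_mod_4:
  fixes Q w :: nat
  assumes Q: "[Q = 3] (mod 4)" and w: "w \<ge> 2"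
  shows "ord (2 ^ w) Q = 2 ^ max 1 (w - multiplicity 2 (Q + 1))"
proof (rule nat_dvd_eqI)
  define v where "v = multiplicity 2 (Q + 1)"
  have Q4: "Q mod 4 = 3" using Q by (simp add: cong_def)
  hence odd: "odd Q" by presburger
  have Q3: "Q \<ge> 3" using Q4 mod_less_eq_dividend[of Q 4] by simp
  have cop: "coprime (2 ^ w) Q" using odd by simp
  thus "ord (2 ^ w) Q > 0" by simp
  have c1: "[Q\<^sup>2 = 1] (mod 4)"
    using cong_pow[OF Q, of 2] by (simp add: cong_def)
  have Q21: "Q\<^sup>2 > 1" using Q3 self_le_power[of Q 2] by simp
  have "multiplicity 2 (Q\<^sup>2 - 1) = multiplicity 2 ((Q + 1) * (Q - 1))"
    by (simp add: power2_eq_square algebra_simps)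
  also have "\<dots> = v + multiplicity 2 (Q - 1)"
    unfolding v_def using Q3 by (intro prime_elem_multiplicity_mult_distrib) auto
  also have "multiplicity 2 (Q - 1) = 1"
  proof (rule multiplicity_eqI)
    show "2 ^ 1 dvd Q - 1" using odd by simp
    show "\<not> 2 ^ Suc 1 dvd Q - 1" using Q4 by (simp, presburger)
  qed
  finally have mult: "multiplicity 2 (Q\<^sup>2 - 1) = v + 1" .
  have "[Q\<^sup>2 = 1] (mod 2)" using odd by (simp add: cong_def mod_2_eq_odd)
  hence ord2: "ord 2 (Q\<^sup>2) = 1" by (simp add: ord_eq_Suc_0_iff)
  have ordQ2: "ord (2 ^ w) (Q\<^sup>2) = 2 ^ (w - (v + 1))"
    using ord_prime_power[of 2 "Q\<^sup>2" w] Q21 odd c1 w ord2 mult by simp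
  fix u :: nat assume u: "u > 0"
  \<comment> \<open>With truncated subtraction, \<open>max 1 (w - v)\<close> is
    \<open>Suc (w - (v + 1))\<close>: one factor 2 for passing to the square, the rest from the
    order of the square.\<close>
  have max: "2 ^ max 1 (w - v) = (2::nat) * 2 ^ (w - (v + 1))"
    by (simp add: max_def flip: power_Suc) (auto simp: not_le)
  show "ord (2 ^ w) Q dvd u \<longleftrightarrow> 2 ^ max 1 (w - multiplicity 2 (Q + 1)) dvd u"
  proof (cases "even u")
    case True
    then obtain c where c: "u = 2 * c" by auto
    have "ord (2 ^ w) Q dvd u \<longleftrightarrow> [(Q\<^sup>2) ^ c = 1] (mod 2 ^ w)"
      by (simp add: c power_mult flip: ord_divides)
    also have "\<dots> \<longleftrightarrow> 2 ^ (w - (v + 1)) dvd c" by (simp only: ord_divides ordQ2)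
    finally show ?thesis using max by (simp add: c v_def)
  next
    case False
    then obtain c where c: "u = Suc (2 * c)" by (auto elim: oddE)
    \<comment> \<open>An odd power of \<open>Q\<close> is still 3 modulo 4, and 4 divides
      \<open>2 ^ w\<close>; so both candidates for the order are even.\<close>
    have "\<not> [Q ^ u = 1] (mod 2 ^ w)"
    proof
      assume "[Q ^ u = 1] (mod 2 ^ w)"
      moreover have "(2::nat) ^ 2 dvd 2 ^ w" using w by (rule le_imp_power_dvd)
      ultimately have "[Q ^ u = 1] (mod 4)" using cong_dvd_modulus_nat by fastforce
      moreover have "[Q ^ u = 3 * 1 ^ c] (mod 4)"
        unfolding c power_Suc power_mult by (intro cong_mult cong_pow c1 Q)
      ultimately show False by (simp add: cong_def)
    qed
    hence "\<not> ord (2 ^ w) Q dvd u" using ord_divides by blast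
    moreover have "\<not> 2 ^ max 1 (w - multiplicity 2 (Q + 1)) dvd u"
      using False max by (simp add: v_def) (metis dvd_mult_left)
    ultimately show ?thesis by simp
  qed
qed simp

section \<open>Sizes of cyclotomic cosets\<close>

text \<open>Dividing by the gcd of \<open>M\<close> and \<open>\<gamma>\<close> leaves a cofactor of
  \<open>\<gamma>\<close> that is coprime to the reduced modulus and can be cancelled, so the
  congruence concerns powers of \<open>q\<close> alone.\<close>

lemma cong_mult_power_iff:
  fixes M q t :: nat and \<gamma> :: int
  assumes "M > 0"
  shows "[\<gamma> * int q ^ t = \<gamma>] (mod int M) \<longleftrightarrow> ord (M div gcd M (nat \<bar>\<gamma>\<bar>)) q dvd t"
proof -
  define d where "d = gcd (int M) \<gamma>"
  have d: "d > 0" using assms by (simp add: d_def)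
  have "d dvd int M" "d dvd \<gamma>" by (simp_all add: d_def)
  then obtain M' \<gamma>' where M': "int M = d * M'" and g': "\<gamma> = d * \<gamma>'"
    by (elim dvdE)
  have cop: "coprime M' \<gamma>'"
  proof -
    have "gcd (d * M') (d * \<gamma>') = d" by (metis d_def M' g')
    hence "d * gcd M' \<gamma>' = d" using d gcd_mult_distrib_int[of d M' \<gamma>'] by simp
    thus ?thesis using d by (simp add: coprime_iff_gcd_eq_1)
  qed
  have eq: "M' = int (M div gcd M (nat \<bar>\<gamma>\<bar>))"
  proof -
    have "d = int (gcd M (nat \<bar>\<gamma>\<bar>))" by (simp only: d_def gcd_int_def abs_of_nat nat_int)
    moreover have "M' = int M div d" unfolding M' using d by simp
    ultimately show ?thesis by (simp only: zdiv_int)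
  qed
  have "[\<gamma> * int q ^ t = \<gamma>] (mod int M) \<longleftrightarrow> d * M' dvd d * (\<gamma>' * (int q ^ t - 1))"
    by (simp add: cong_iff_dvd_diff M' g' algebra_simps)
  also have "\<dots> \<longleftrightarrow> M' dvd int q ^ t - 1"
    using d cop by (simp add: coprime_dvd_mult_right_iff)
  also have "\<dots> \<longleftrightarrow> [int (q ^ t) = int 1] (mod int (M div gcd M (nat \<bar>\<gamma>\<bar>)))"
    by (simp add: cong_iff_dvd_diff eq)
  also have "\<dots> \<longleftrightarrow> ord (M div gcd M (nat \<bar>\<gamma>\<bar>)) q dvd t"
    by (simp only: cong_int_iff ord_divides)
  finally show ?thesis .
qed

lemma coprime_div_gcd:
  fixes M q k :: nat
  assumes "coprime M q"
  shows "coprime (M div gcd M k) q"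
proof -
  have "M div gcd M k dvd M" by (metis dvd_mult_div_cancel dvd_triv_right gcd_dvd1)
  thus ?thesis using assms by (meson coprime_divisors dvd_refl)
qed

lemma card_cyc_coset:
  fixes M q :: nat and \<gamma> :: int
  assumes M: "M > 0" "coprime M q"
  shows "card (cyc_coset q M \<gamma>) = ord (M div gcd M (nat \<bar>\<gamma>\<bar>)) q"
proof -
  let ?o = "ord (M div gcd M (nat \<bar>\<gamma>\<bar>)) q"
  have o: "?o > 0" using coprime_div_gcd[OF M(2)] ord_gt_0_iff by blast
  have per: "coset_period q M \<gamma> = ?o"
    unfolding coset_period_def cong_mult_power_iff[OF M(1)]
    by (rule Least_equality) (use o in \<open>auto intro: dvd_imp_le\<close>)
  \<comment> \<open>A repetition within one period would, after cancelling the unit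
    \<open>q ^ a\<close>, give a period smaller than the least one.\<close>
  have neq: "(\<gamma> * int q ^ a) mod int M \<noteq> (\<gamma> * int q ^ b) mod int M" if "a < b" "b < ?o" for a b
  proof
    assume "(\<gamma> * int q ^ a) mod int M = (\<gamma> * int q ^ b) mod int M"
    hence "[\<gamma> * int q ^ (b - a) * int q ^ a = \<gamma> * int q ^ a] (mod int M)"
      using that by (simp add: cong_def mult.assoc flip: power_add)
    moreover have "coprime (int q ^ a) (int M)" using M(2) by (simp add: coprime_commute)
    ultimately have "[\<gamma> * int q ^ (b - a) = \<gamma>] (mod int M)"
      using cong_mult_rcancel by blast
    hence "?o dvd b - a" using cong_mult_power_iff[OF M(1)] by simp
    thus False using that by (auto dest: dvd_imp_le)
  qed
  have "inj_on (\<lambda>i. (\<gamma> * int q ^ i) mod int M) {0..<?o}"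
    by (rule inj_onI) (metis neq atLeastLessThan_iff linorder_neqE_nat)
  thus ?thesis by (simp add: cyc_coset_def per card_image)
qed

text \<open>This form hides the gcd and allows sizes to be compared through their multiples.\<close>

lemma card_cyc_coset_dvd_iff:
  fixes M q t :: nat and \<gamma> :: int
  assumes "M > 0" "coprime M q"
  shows "card (cyc_coset q M \<gamma>) dvd t \<longleftrightarrow> [\<gamma> * int q ^ t = \<gamma>] (mod int M)"
  using assms by (simp add: card_cyc_coset cong_mult_power_iff)

lemma card_cyc_coset_pos:
  fixes M q :: nat and \<gamma> :: int
  assumes "M > 0" "coprime M q"
  shows "card (cyc_coset q M \<gamma>) > 0"
  using coprime_div_gcd[OF assms(2)] card_cyc_coset[OF assms] ord_gt_0_iff by metis

text \<open>By coprimality the congruence splits into one modulo \<open>B\<close> and one modulo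
  \<open>l ^ J\<close>. The first depends only on \<open>g\<close> and forces
  \<open>t = \<theta> * c\<close>. In the second, \<open>l ^ i\<close> cancels from
  \<open>g'\<close> and the modulus, and the remaining unit cancels too, which leaves the order of
  \<open>q ^ \<theta>\<close> modulo \<open>l ^ (J - i)\<close>.\<close>

lemma card_cyc_coset_mult_prime_power:
  fixes B q l J i :: nat and g g' :: int
  assumes B: "B > 0" "coprime B q" and l: "prime l" "\<not> l dvd B" "coprime l q"
    and cong: "[g' = g] (mod int B)" and i: "i \<le> J"
    and dvd: "int l ^ i dvd g'" "i < J \<Longrightarrow> \<not> int l ^ Suc i dvd g'"
  defines "\<theta> \<equiv> card (cyc_coset q B g)"
  shows "card (cyc_coset q (B * l ^ J) g') = \<theta> * ord (l ^ (J - i)) (q ^ \<theta>)"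
proof (rule nat_dvd_eqI)
  have cop: "coprime (B * l ^ J) q" using B l by simp
  have l0: "l > 0" using l prime_gt_0_nat by blast
  have pos: "B * l ^ J > 0" using B l0 by simp
  show "card (cyc_coset q (B * l ^ J) g') > 0" using card_cyc_coset_pos[OF pos cop] .
  have \<theta>: "\<theta> > 0" unfolding \<theta>_def using card_cyc_coset_pos B by blast
  have "coprime (l ^ (J - i)) (q ^ \<theta>)" using l by simp
  thus "\<theta> * ord (l ^ (J - i)) (q ^ \<theta>) > 0" using \<theta> by simp
  obtain h where h: "g' = int l ^ i * h" using dvd by auto
  \<comment> \<open>If \<open>i = J\<close>, the remaining modulus is 1 and nothing is required of
    \<open>h\<close>.\<close>
  have coph: "coprime (int l ^ (J - i)) h"
  proof (cases "i < J")
    case True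
    have "\<not> int l dvd h"
      using dvd(2)[OF True] l0 by (simp add: h)
    thus ?thesis using l(1) by (simp add: prime_imp_coprime)
  qed (use i in auto)
  fix t :: nat
  have copB: "coprime (int B) (int l ^ J)"
    using l(1,2) prime_imp_coprime[of l B] by (simp add: coprime_commute)
  have "card (cyc_coset q (B * l ^ J) g') dvd t
      \<longleftrightarrow> [g' * int q ^ t = g'] (mod int B * int l ^ J)"
    using card_cyc_coset_dvd_iff[OF pos cop] by simp
  also have "\<dots> \<longleftrightarrow> [g' * int q ^ t = g'] (mod int B) \<and> [g' * int q ^ t = g'] (mod int l ^ J)"
    unfolding cong_iff_dvd_diff
    by (intro iffI conjI divides_mult copB) (blast dest: dvd_mult_left dvd_mult_right)+
  also have "[g' * int q ^ t = g'] (mod int B) \<longleftrightarrow> [g * int q ^ t = g] (mod int B)"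
    by (meson cong cong_scalar_right cong_sym cong_trans)
  also have "\<dots> \<longleftrightarrow> \<theta> dvd t"
    using card_cyc_coset_dvd_iff[OF B] by (simp add: \<theta>_def)
  also have "\<theta> dvd t \<and> [g' * int q ^ t = g'] (mod int l ^ J) \<longleftrightarrow> \<theta> * ord (l ^ (J - i)) (q ^ \<theta>) dvd t"
  proof (cases "\<theta> dvd t")
    case True
    then obtain c where c: "t = \<theta> * c" by auto
    have "int l ^ J = int l ^ i * int l ^ (J - i)" using i by (simp flip: power_add)
    hence "[g' * int q ^ t = g'] (mod int l ^ J)
        \<longleftrightarrow> int l ^ i * int l ^ (J - i) dvd int l ^ i * (h * (int q ^ t - 1))"
      by (simp add: cong_iff_dvd_diff h algebra_simps)
    also have "\<dots> \<longleftrightarrow> int l ^ (J - i) dvd int q ^ t - 1"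
      using l0 coph by (simp add: coprime_dvd_mult_right_iff)
    also have "\<dots> \<longleftrightarrow> [int ((q ^ \<theta>) ^ c) = int 1] (mod int (l ^ (J - i)))"
      by (simp add: cong_iff_dvd_diff c power_mult)
    also have "\<dots> \<longleftrightarrow> ord (l ^ (J - i)) (q ^ \<theta>) dvd c"
      by (simp only: cong_int_iff ord_divides)
    finally show ?thesis using \<theta> by (simp add: c)
  qed (auto dest: dvd_mult_left)
  finally show "card (cyc_coset q (B * l ^ J) g') dvd t \<longleftrightarrow> \<theta> * ord (l ^ (J - i)) (q ^ \<theta>) dvd t" .
qed

section \<open>Adic digits\<close>

lemma sum_digits_less_power:
  fixes \<phi> :: "nat \<Rightarrow> nat"
  assumes "\<And>k. \<phi> k < l"
  shows "(\<Sum>k<i. \<phi> k * l ^ k) < l ^ i"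
proof (induction i)
  case (Suc i)
  have "(\<Sum>k<Suc i. \<phi> k * l ^ k) < (\<phi> i + 1) * l ^ i" using Suc by simp
  also have "\<dots> \<le> l * l ^ i" using assms[of i] by (intro mult_right_mono) auto
  finally show ?case by simp
qed auto

text \<open>Justifies the definite description in \<open>phi_digit\<close>. As \<open>B\<close> is
  invertible modulo each \<open>l ^ i\<close>, the partial sum of length \<open>i\<close> is the
  unique solution below \<open>l ^ i\<close>; these solutions are compatible, and their successive
  differences give the digits.\<close>

lemma ex1_adic_digits:
  fixes B l :: nat and \<delta> :: int
  assumes cop: "coprime B l" and l: "l > 0"
  shows "\<exists>!\<phi>. (\<forall>k. \<phi> k < l) \<and> (\<forall>i. [int B * int (\<Sum>k<i. \<phi> k * l ^ k) = - \<delta>] (mod int l ^ i))"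
proof (rule ex_ex1I)
  have copi: "coprime (int B) (int l ^ i)" for i using cop by simp
  have unique: "x = y"
    if "x < l ^ i" "y < l ^ i" "[int B * int x = - \<delta>] (mod int l ^ i)"
      "[int B * int y = - \<delta>] (mod int l ^ i)" for i x y :: nat
  proof -
    have "[int B * int x = int B * int y] (mod int l ^ i)"
      using that(3,4) cong_sym cong_trans by blast
    hence "[int x = int y] (mod int (l ^ i))" using copi[of i] by (simp add: cong_mult_lcancel)
    hence "[x = y] (mod l ^ i)" by (simp only: cong_int_iff)
    thus ?thesis using that(1,2) by (rule cong_less_modulus_unique_nat)
  qed
  show "\<phi> = \<psi>"
    if \<phi>: "(\<forall>k. \<phi> k < l) \<and> (\<forall>i. [int B * int (\<Sum>k<i. \<phi> k * l ^ k) = - \<delta>] (mod int l ^ i))"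
      and \<psi>: "(\<forall>k. \<psi> k < l) \<and> (\<forall>i. [int B * int (\<Sum>k<i. \<psi> k * l ^ k) = - \<delta>] (mod int l ^ i))"
    for \<phi> \<psi> :: "nat \<Rightarrow> nat"
  proof
    have eq: "(\<Sum>k<i. \<phi> k * l ^ k) = (\<Sum>k<i. \<psi> k * l ^ k)" for i
      using \<phi> \<psi> by (intro unique[of _ i] sum_digits_less_power) auto
    fix k
    show "\<phi> k = \<psi> k" using eq[of "Suc k"] eq[of k] l by simp
  qed
  have "\<exists>c::nat. c < l ^ i \<and> [int B * int c = - \<delta>] (mod int l ^ i)" for i
  proof -
    obtain b where b: "[int B * b = 1] (mod int l ^ i)"
      using cong_solve_coprime_int[OF copi] by blast
    define c where "c = nat ((- \<delta> * b) mod int l ^ i)"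
    have pos: "int l ^ i > 0" using l by simp
    have c: "int c = (- \<delta> * b) mod int l ^ i" using pos by (simp add: c_def)
    have "[int B * int c = int B * (- \<delta> * b)] (mod int l ^ i)"
      unfolding c by (intro cong_scalar_left) (simp add: cong_def)
    also have "int B * (- \<delta> * b) = - \<delta> * (int B * b)" by (simp add: algebra_simps)
    also have "[\<dots> = - \<delta> * 1] (mod int l ^ i)" by (intro cong_scalar_left b)
    finally have "[int B * int c = - \<delta>] (mod int l ^ i)" by simp
    moreover have "int c < int (l ^ i)" unfolding c using pos by simp
    ultimately show ?thesis by (metis of_nat_less_iff)
  qed
  then obtain c :: "nat \<Rightarrow> nat" where
    c: "\<And>i. c i < l ^ i" "\<And>i. [int B * int (c i) = - \<delta>] (mod int l ^ i)" by metis
  have c_Suc: "c (Suc i) mod l ^ i = c i" for i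
  proof (rule unique)
    show "c (Suc i) mod l ^ i < l ^ i" using l by simp
    have "[int B * int (c (Suc i) mod l ^ i) = int B * int (c (Suc i))] (mod int l ^ i)"
      by (intro cong_scalar_left) (simp add: cong_def zmod_int)
    also have "[int B * int (c (Suc i)) = - \<delta>] (mod int l ^ i)"
      using c(2)[of "Suc i"] by (rule cong_dvd_modulus) simp
    finally show "[int B * int (c (Suc i) mod l ^ i) = - \<delta>] (mod int l ^ i)" .
  qed (use c in auto)
  \<comment> \<open>By compatibility, \<open>c (Suc i)\<close> is \<open>c i\<close> plus a multiple
    of \<open>l ^ i\<close>; the quotient is the next digit.\<close>
  define \<phi> where "\<phi> i = c (Suc i) div l ^ i" for i
  have "(\<Sum>k<i. \<phi> k * l ^ k) = c i" for i
  proof (induction i)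
    case (Suc i)
    thus ?case using c_Suc[of i] div_mult_mod_eq[of "c (Suc i)" "l ^ i"] by (simp add: \<phi>_def)
  qed (use c(1)[of 0] in simp)
  moreover have "\<phi> k < l" for k
    using c(1)[of "Suc k"] unfolding \<phi>_def by (intro less_mult_imp_div_less) simp
  ultimately show "\<exists>\<phi>. (\<forall>k. \<phi> k < l) \<and>
      (\<forall>i. [int B * int (\<Sum>k<i. \<phi> k * l ^ k) = - \<delta>] (mod int l ^ i))"
    using c(2) by (intro exI[of _ \<phi>]) auto
qed

text \<open>All later arguments about the digits rest on these two facts.\<close>

lemma
  fixes B l :: nat and \<delta> :: int
  assumes "coprime B l" "l > 0"
  shows phi_digit_less: "phi_digit B l \<delta> k < l"
    and power_dvd_add_phi_digits:
      "int l ^ i dvd \<delta> + int (B * (\<Sum>k<i. phi_digit B l \<delta> k * l ^ k))"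
proof -
  note * = theI'[OF ex1_adic_digits[OF assms, of \<delta>], folded phi_digit_def]
  show "phi_digit B l \<delta> k < l" using * by blast
  have "[int B * int (\<Sum>k<i. phi_digit B l \<delta> k * l ^ k) = - \<delta>] (mod int l ^ i)"
    using * by blast
  thus "int l ^ i dvd \<delta> + int (B * (\<Sum>k<i. phi_digit B l \<delta> k * l ^ k))"
    by (simp add: cong_iff_dvd_diff add.commute)
qed

lemma power_dvd_add_phi_trunc:
  fixes B l J :: nat and \<delta> :: int
  assumes "coprime B l" "l > 0" "J \<ge> 1"
  shows "int l ^ J dvd \<delta> + int (B * phi_trunc B l \<delta> (J - 1))"
proof -
  \<comment> \<open>\<open>phi_trunc\<close> includes its last index, so truncation at
    \<open>J - 1\<close> keeps exactly \<open>J\<close> digits.\<close>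
  have "{..J - 1} = {..<J}" using assms(3) by auto
  thus ?thesis using power_dvd_add_phi_digits[OF assms(1,2)] by (simp add: phi_trunc_def)
qed

text \<open>The first \<open>i\<close> correct digits give divisibility by \<open>l ^ i\<close>.
  Replacing the next digit by \<open>u\<close> changes the value by
  \<open>B * (u - \<phi> i) * l ^ i\<close>, where \<open>l\<close> divides neither \<open>B\<close>
  nor the difference of two distinct digits. The free \<open>x\<close> absorbs all higher terms, in
  particular those from \<open>t k\<close>.\<close>

lemma wrong_phi_digit:
  fixes B l i u x :: nat and \<delta> :: int
  assumes l: "prime l" "coprime B l" and u: "u < l" "u \<noteq> phi_digit B l \<delta> i"
  defines "g \<equiv> \<delta> + int (B * ((\<Sum>k<i. phi_digit B l \<delta> k * l ^ k) + u * l ^ i + l ^ Suc i * x))"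
  shows "int l ^ i dvd g" "\<not> int l ^ Suc i dvd g"
proof -
  define \<phi> where "\<phi> = phi_digit B l \<delta>"
  have l0: "l > 0" using l prime_gt_0_nat by blast
  have "int l ^ i dvd \<delta> + int (B * (\<Sum>k<i. \<phi> k * l ^ k))"
    unfolding \<phi>_def by (rule power_dvd_add_phi_digits[OF l(2) l0])
  moreover have "g = (\<delta> + int (B * (\<Sum>k<i. \<phi> k * l ^ k))) + int l ^ i * int (B * (u + l * x))"
    by (simp add: g_def \<phi>_def algebra_simps)
  ultimately show "int l ^ i dvd g" by (metis dvd_add dvd_triv_left)
  define h where "h = \<delta> + int (B * (\<Sum>k<Suc i. \<phi> k * l ^ k))"
  have h: "int l ^ Suc i dvd h"
    unfolding h_def \<phi>_def by (rule power_dvd_add_phi_digits[OF l(2) l0])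
  have g: "g = h + int l ^ Suc i * int (B * x) + int l ^ i * (int B * (int u - int (\<phi> i)))"
    by (simp add: g_def h_def \<phi>_def algebra_simps)
  show "\<not> int l ^ Suc i dvd g"
  proof
    assume "int l ^ Suc i dvd g"
    moreover have "int l ^ Suc i dvd h + int l ^ Suc i * int (B * x)"
      using h by (metis dvd_add dvd_triv_left)
    ultimately have "int l ^ Suc i dvd int l ^ i * (int B * (int u - int (\<phi> i)))"
      unfolding g using dvd_add_right_iff by blast
    hence "int l ^ i * int l dvd int l ^ i * (int B * (int u - int (\<phi> i)))"
      by (simp add: mult.commute)
    hence "int l dvd int B * (int u - int (\<phi> i))" using l0 by simp
    moreover have "coprime (int l) (int B)" using l(2) by (simp add: coprime_commute)
    ultimately have "int l dvd int u - int (\<phi> i)" by (simp add: coprime_dvd_mult_right_iff)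
    hence "[u = \<phi> i] (mod l)" by (simp add: cong_iff_dvd_diff flip: cong_int_iff)
    moreover have "\<phi> i < l" unfolding \<phi>_def by (rule phi_digit_less[OF l(2) l0])
    ultimately have "u = \<phi> i" using u(1) cong_less_modulus_unique_nat by blast
    thus False using u(2) by (simp add: \<phi>_def)
  qed
qed

section \<open>Cosets of power subgroups\<close>

lemma
  assumes "prime l"
  shows comm_group_units_mod: "comm_group (units_mod l)"
    and finite_carrier_units_mod: "finite (carrier (units_mod l))"
    and order_units_mod: "order (units_mod l) = l - 1"
    and mod_mem_units_mod: "\<not> l dvd x \<Longrightarrow> int x mod int l \<in> carrier (units_mod l)"
proof -
  interpret residues_prime l "residue_ring (int l)" by unfold_locales (rule assms)
  show "comm_group (units_mod l)" by (rule units_comm_group)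
  show "finite (carrier (units_mod l))" by (simp add: units_of_carrier)
  show "order (units_mod l) = l - 1"
    by (simp add: Coset.order_def units_of_carrier res_prime_units_eq)
  show "int x mod int l \<in> carrier (units_mod l)" if "\<not> l dvd x"
    using that m_gt_one by (simp add: units_of_carrier p_coprime_right_int)
qed

lemma subgroup_power_subgroup:
  assumes "prime l" "\<not> l dvd x"
  shows "subgroup (power_subgroup l x) (units_mod l)"
proof -
  interpret G: comm_group "units_mod l" by (rule comm_group_units_mod[OF assms(1)])
  show ?thesis
    unfolding power_subgroup_def using mod_mem_units_mod[OF assms] by (intro G.generate_is_subgroup) simp
qed

text \<open>The subgroup is cyclic, so its size is the group-theoretic order of its generator, which
  has the same multiples as the arithmetic order.\<close>

lemma card_power_subgroup:
  assumes "prime l" "\<not> l dvd x"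
  shows "card (power_subgroup l x) = ord l x"
proof (rule nat_dvd_eqI)
  interpret residues_prime l "residue_ring (int l)" by unfold_locales (rule assms)
  interpret G: comm_group "units_mod l" by (rule units_comm_group)
  let ?a = "int x mod int l"
  have a: "?a \<in> carrier (units_mod l)" by (rule mod_mem_units_mod[OF assms])
  have card: "card (power_subgroup l x) = G.ord ?a"
    by (simp add: power_subgroup_def G.generate_pow_card[OF a])
  show "card (power_subgroup l x) > 0"
    unfolding card using G.ord_ge_1[OF finite_carrier_units_mod[OF assms(1)] a] by simp
  show "ord l x > 0" using assms p_coprime_left by simp
  fix u :: nat
  have "card (power_subgroup l x) dvd u \<longleftrightarrow> ?a [^]\<^bsub>units_mod l\<^esub> u = \<one>\<^bsub>units_mod l\<^esub>"
    unfolding card by (simp add: G.pow_eq_id[OF a])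
  also have "\<dots> \<longleftrightarrow> ?a [^]\<^bsub>residue_ring (int l)\<^esub> u = \<one>\<^bsub>residue_ring (int l)\<^esub>"
    using a by (simp add: units_of_pow units_of_one units_of_carrier)
  also have "\<dots> \<longleftrightarrow> [int (x ^ u) = int 1] (mod int l)"
    unfolding pow_cong one_cong by (simp add: cong_def)
  also have "\<dots> \<longleftrightarrow> ord l x dvd u" by (simp only: cong_int_iff ord_divides)
  finally show "card (power_subgroup l x) dvd u \<longleftrightarrow> ord l x dvd u" .
qed

text \<open>Lagrange's theorem; it turns each index \<open>r\<^sub>k\<close> into a statement about
  orders.\<close>

lemma unit_index_mult_ord:
  assumes "prime l" "\<not> l dvd x"
  shows "unit_index l x * ord l x = l - 1"
proof -
  interpret G: comm_group "units_mod l" by (rule comm_group_units_mod[OF assms(1)])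
  show ?thesis
    using G.lagrange_finite[OF finite_carrier_units_mod[OF assms(1)] subgroup_power_subgroup[OF assms]]
    by (simp add: unit_index_def card_power_subgroup[OF assms] order_units_mod[OF assms(1)])
qed

text \<open>Ensures that the sorted list of \<open>R\<close> is long enough for every admissible
  index \<open>a\<close>. Picking the representative of each coset is injective because distinct
  cosets are disjoint.\<close>

lemma unit_index_le_card_full_reps:
  assumes "prime l" "\<not> l dvd x" and R: "full_reps l x R"
  shows "unit_index l x \<le> card R"
  unfolding unit_index_def
proof (rule card_inj_on_le)
  interpret G: comm_group "units_mod l" by (rule comm_group_units_mod[OF assms(1)])
  define f where "f C = (THE u. u \<in> R \<and> int u \<in> C)" for C
  have f: "f C \<in> R" "int (f C) \<in> C" if "C \<in> rcosets\<^bsub>units_mod l\<^esub> power_subgroup l x" for C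
    using R that theI'[of "\<lambda>u. u \<in> R \<and> int u \<in> C"] unfolding full_reps_def f_def by blast+
  show "f ` (rcosets\<^bsub>units_mod l\<^esub> power_subgroup l x) \<subseteq> R" using f(1) by auto
  show "finite R" using R by (auto simp: full_reps_def intro: finite_subset)
  show "inj_on f (rcosets\<^bsub>units_mod l\<^esub> power_subgroup l x)"
  proof (rule inj_onI)
    fix C D
    assume C: "C \<in> rcosets\<^bsub>units_mod l\<^esub> power_subgroup l x"
      and D: "D \<in> rcosets\<^bsub>units_mod l\<^esub> power_subgroup l x" and eq: "f C = f D"
    have "\<not> disjnt C D" using f(2)[OF C] f(2)[OF D] eq by (auto simp: disjnt_def)
    thus "C = D"
      using G.rcos_disjoint[OF subgroup_power_subgroup[OF assms(1,2)]] C D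
      by (auto simp: pairwise_def)
  qed
qed

section \<open>The digit chosen by \<open>U\<close>, and \<open>rk\<close> and \<open>vk\<close> in
  terms of orders\<close>

text \<open>Both rules for the digit \<open>u\<close> avoid \<open>\<phi> m\<close>: the first
  removes it from the list of candidates, the second shifts it by a nonzero residue.\<close>

lemma U_eq_wrong_digit:
  fixes q B l m a :: nat and \<delta> :: int
  defines "\<theta> \<equiv> card (cyc_coset q B \<delta>)"
  assumes l: "prime l" "coprime B l" "\<not> l dvd q ^ \<theta>" and a: "a \<in> {1..rk q l \<theta>}"
    and R: "\<not> l dvd q ^ \<theta> - 1 \<Longrightarrow> full_reps l (q ^ \<theta>) (R B l \<delta>)"
  obtains u where "u < l" "u \<noteq> phi_digit B l \<delta> m"
    "U q R B l \<delta> m a = (\<Sum>k<m. phi_digit B l \<delta> k * l ^ k) + u * l ^ m"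
proof -
  define \<phi> where "\<phi> = phi_digit B l \<delta>"
  have l0: "l > 0" using l prime_gt_0_nat by blast
  have \<phi>: "\<phi> m < l" unfolding \<phi>_def by (rule phi_digit_less[OF l(2) l0])
  define u where "u = (if l dvd q ^ \<theta> - 1
      then sorted_list_of_set ({0..l - 1} - {\<phi> m}) ! (a - 1)
      else (\<phi> m + sorted_list_of_set (R B l \<delta>) ! (a - 1)) mod l)"
  have "u < l \<and> u \<noteq> \<phi> m"
  proof (cases "l dvd q ^ \<theta> - 1")
    case True
    let ?A = "{0..l - 1} - {\<phi> m}"
    \<comment> \<open>The index is at most \<open>l - 1\<close>, the number of digits other than
      \<open>\<phi> m\<close>, so position \<open>a - 1\<close> exists.\<close>
    have "rk q l \<theta> dvd l - 1"
      unfolding rk_def by (metis dvd_triv_left unit_index_mult_ord[OF l(1,3)])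
    moreover have "l - 1 > 0" using prime_gt_1_nat[OF l(1)] by simp
    ultimately have "rk q l \<theta> \<le> l - 1" by (rule dvd_imp_le)
    moreover have "card ?A = l - 1" using \<phi> by (subst card_Diff_singleton) auto
    ultimately have "a - 1 < length (sorted_list_of_set ?A)" using a by auto
    hence "sorted_list_of_set ?A ! (a - 1) \<in> set (sorted_list_of_set ?A)" by (rule nth_mem)
    hence "u \<in> ?A" using True by (simp add: u_def)
    thus ?thesis using l0 by auto
  next
    case False
    let ?A = "R B l \<delta>"
    have A: "?A \<subseteq> {1..l - 1}" using R[OF False] by (simp add: full_reps_def)
    hence fin: "finite ?A" by (rule finite_subset) auto
    have "rk q l \<theta> \<le> card ?A"
      unfolding rk_def using unit_index_le_card_full_reps[OF l(1,3) R[OF False]] .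
    hence "a - 1 < length (sorted_list_of_set ?A)" using a by auto
    hence "sorted_list_of_set ?A ! (a - 1) \<in> set (sorted_list_of_set ?A)" by (rule nth_mem)
    then obtain \<sigma> where \<sigma>: "u = (\<phi> m + \<sigma>) mod l" "\<sigma> \<in> ?A"
      using False fin by (simp add: u_def)
    hence "1 \<le> \<sigma>" "\<sigma> < l" using A l0 by fastforce+
    \<comment> \<open>The sum lies below \<open>2 * l\<close>, so reduction subtracts
      \<open>l\<close> at most once, and \<open>0 < \<sigma> < l\<close> rules out a return to
      \<open>\<phi> m\<close>.\<close>
    thus ?thesis using \<phi> l0 by (auto simp: \<sigma>(1) mod_if)
  qed
  moreover have "U q R B l \<delta> m a = (\<Sum>k<m. \<phi> k * l ^ k) + u * l ^ m"
    by (simp add: U_def Let_def u_def \<phi>_def \<theta>_def)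
  ultimately show ?thesis using that[of u] by (simp add: \<phi>_def)
qed

text \<open>Translates the factors of \<open>tau\<close> into the \<open>f\<close> and
  \<open>v\<close> of \<open>ord_prime_power\<close> for \<open>Q = q ^ t\<close>.\<close>

lemma
  assumes "prime l" "\<not> l dvd q ^ t"
  shows rk_pos: "rk q l t > 0"
    and div_rk: "(l - 1) div rk q l t = ord l (q ^ t)"
    and vk_altdef: "vk q l t = multiplicity l ((q ^ t) ^ ord l (q ^ t) - 1)"
proof -
  have eq: "l - 1 = rk q l t * ord l (q ^ t)"
    unfolding rk_def by (rule unit_index_mult_ord[OF assms, symmetric])
  show pos: "rk q l t > 0" using eq prime_gt_1_nat[OF assms(1)] by (cases "rk q l t") auto
  show "(l - 1) div rk q l t = ord l (q ^ t)" unfolding eq using pos by simp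
  have "t * (l - 1) div rk q l t = t * ord l (q ^ t)"
    unfolding eq using pos by (simp add: mult.left_commute)
  thus "vk q l t = multiplicity l ((q ^ t) ^ ord l (q ^ t) - 1)"
    by (simp add: vk_def power_mult)
qed

section \<open>The recursion over the primes\<close>

lemma prime_not_dvd_Bk:
  assumes "prime (P k)" "\<not> P k dvd n" "\<And>i. i \<in> {1..<k} \<Longrightarrow> prime (P i) \<and> P i \<noteq> P k"
  shows "\<not> P k dvd Bk n P j k"
proof -
  have "coprime (P k) (\<Prod>i\<in>{1..<k}. P i ^ j i)"
    using assms(1,3) by (intro prod_coprime_right) (metis coprime_power_right_iff primes_coprime)
  hence "coprime (P k) (Bk n P j k)"
    using assms(1,2) by (simp add: Bk_def prime_imp_coprime)
  thus ?thesis using assms(1) coprime_absorb_left not_prime_unit by blast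
qed

lemma Bk_Suc: "Bk n P j (Suc (Suc k)) = Bk n P j (Suc k) * P (Suc k) ^ j (Suc k)"
  by (simp add: Bk_def)

theorem corollary7p3:
  fixes p e q n n' s \<tau> :: nat
    and P j :: "nat \<Rightarrow> nat"
    and \<gamma> :: int
    and R :: "nat \<Rightarrow> nat \<Rightarrow> int \<Rightarrow> nat set"
    and m :: "nat \<Rightarrow> enat"
    and a t :: "nat \<Rightarrow> nat"
  assumes "prime p" and "e \<ge> 1" and "q = p ^ e"
    and "n > 0" and "coprime n q"
    and "s \<ge> 1"
    and "\<And>k. k \<in> {1..s} \<Longrightarrow> prime (P k) \<and> P k \<noteq> p \<and> \<not> P k dvd n"
    and "strict_mono_on {1..s} P"
    and "\<And>k. k \<in> {1..s} \<Longrightarrow> j k \<ge> 1"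
    and "n' = (\<Prod>k=1..s. P k ^ j k)"
    and "\<tau> = card (cyc_coset q n \<gamma>)"
    and "\<And>B l \<delta>. \<lbrakk>B > 0; coprime B q; prime l; \<not> l dvd B; l \<noteq> p;
             \<not> l dvd q ^ card (cyc_coset q B \<delta>) - 1\<rbrakk>
           \<Longrightarrow> full_reps l (q ^ card (cyc_coset q B \<delta>)) (R B l \<delta>)"
    and "(m, a, t) \<in> index_set q n \<gamma> s P j"
  shows "card (cyc_coset q (n * n') (gamma_rep q R n \<gamma> P j m a t s)) = tau q \<tau> P j m s"
proof -
  note prime_P = assms(7) and R = assms(12)
  have q1: "q > 1" using assms(1-3) by (metis One_nat_def Suc_le_lessD one_less_power prime_gt_1_nat)
  have cop_P: "coprime (P k) q" if "k \<in> {1..s}" for k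
    using prime_P[OF that] assms(1,3) by (simp add: primes_coprime)
  have P_less: "P i < P k" if "i \<in> {1..s}" "k \<in> {1..s}" "i < k" for i k
    using assms(8) that by (auto simp: strict_mono_on_def)
  have m_PiE: "m \<in> (\<Pi>\<^sub>E k\<in>{1..s}. enat ` {0..j k - 1} \<union> {\<infinity>})"
    using assms(13) unfolding index_set_def by blast
  \<comment> \<open>In the exceptional case \<open>gamma_rep\<close> passes the constant 1 to
    \<open>U\<close> in place of \<open>a k\<close>, so only the other case is extracted.\<close>
  have a_range: "a k \<in> {1..rk q (P k) (tau q \<tau> P j m (k - 1))}"
    if "k \<in> {1..s}" "m k = enat i" "\<not> (k = 1 \<and> exceptional q \<tau> P)" for k i
  proof -
    have "let \<tau> = card (cyc_coset q n \<gamma>); l = P k; \<tau>' = tau q \<tau> P j m (k - 1) in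
        case m k of
          \<infinity> \<Rightarrow> a k = 0 \<and> t k = 0
        | enat i \<Rightarrow>
            if k = 1 \<and> exceptional q \<tau> P
            then a k = 1 \<and> t k \<in> {0..2 ^ min (v1_exc q \<tau> - 1) (j k - i - 2) - 1}
            else a k \<in> {1..rk q l \<tau>'} \<and>
                 t k \<in> {0..l ^ (min (vk q l \<tau>') (j k - i) - 1) - 1}"
      using assms(13) that(1) unfolding index_set_def by blast
    thus ?thesis
      unfolding Let_def assms(11)[symmetric] that(2) enat.case using that(3) by (simp split: if_splits)
  qed
  let ?g = "gamma_rep q R n \<gamma> P j m a t" and ?tau = "tau q \<tau> P j m"
  \<comment> \<open>Invariant of the recursion: after \<open>k\<close> steps the modulus is
    \<open>Bk n P j (Suc k)\<close>, which is \<open>n\<close> at \<open>k = 0\<close> and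
    \<open>n * n'\<close> at \<open>k = s\<close>.\<close>
  have "coprime (Bk n P j (Suc k)) q \<and> Bk n P j (Suc k) > 0 \<and>
      card (cyc_coset q (Bk n P j (Suc k)) (?g k)) = ?tau k" if "k \<le> s" for k
    using that
  proof (induction k)
    case 0
    thus ?case using assms(4,5,11) by (simp add: Bk_def)
  next
    case (Suc k)
    define l where "l = P (Suc k)"
    define J where "J = j (Suc k)"
    define B where "B = Bk n P j (Suc k)"
    define \<theta> where "\<theta> = ?tau k"
    define Q where "Q = q ^ \<theta>"
    have mem: "Suc k \<in> {1..s}" using Suc.prems by auto
    have l: "prime l" "l \<noteq> p" "coprime l q" using prime_P[OF mem] cop_P[OF mem] by (auto simp: l_def)
    have l0: "l > 0" using l prime_gt_0_nat by blast
    have B: "coprime B q" "B > 0" and \<theta>: "card (cyc_coset q B (?g k)) = \<theta>"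
      using Suc by (auto simp: B_def \<theta>_def)
    have ldB: "\<not> l dvd B"
      unfolding l_def B_def
    proof (rule prime_not_dvd_Bk)
      fix i assume i: "i \<in> {1..<Suc k}"
      hence "i \<in> {1..s}" "i < Suc k" using Suc.prems by auto
      thus "prime (P i) \<and> P i \<noteq> P (Suc k)" using prime_P[of i] P_less[of i "Suc k"] mem by auto
    qed (use prime_P[OF mem] in auto)
    have copBl: "coprime B l" using prime_imp_coprime[OF l(1) ldB] by (simp add: coprime_commute)
    have \<theta>_pos: "\<theta> > 0" using card_cyc_coset_pos[OF B(2,1)] \<theta> by metis
    have Q1: "Q > 1" unfolding Q_def using q1 \<theta>_pos by (rule one_less_power)
    have "coprime l Q" using l by (simp add: Q_def)
    hence ldQ: "\<not> l dvd Q" using l(1) coprime_absorb_left not_prime_unit by blast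
    have J: "J \<ge> 1" using assms(9)[OF mem] by (simp add: J_def)
    have BS: "Bk n P j (Suc (Suc k)) = B * l ^ J" by (simp only: Bk_Suc B_def l_def J_def)
    have step: "card (cyc_coset q (B * l ^ J) g') = \<theta> * ord (l ^ (J - i)) Q"
      if "[g' = ?g k] (mod int B)" "i \<le> J" "int l ^ i dvd g'" "i < J \<Longrightarrow> \<not> int l ^ Suc i dvd g'"
      for g' i
      using card_cyc_coset_mult_prime_power[OF B(2,1) l(1) ldB l(3) that] unfolding \<theta> Q_def .
    have m_mem: "m (Suc k) \<in> enat ` {0..J - 1} \<union> {\<infinity>}"
      unfolding J_def by (rule PiE_mem[OF m_PiE mem])
    have "card (cyc_coset q (B * l ^ J) (?g (Suc k))) = ?tau (Suc k)"
    proof (cases "m (Suc k)")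
      case infinity
      have g': "?g (Suc k) = ?g k + int (B * phi_trunc B l (?g k) (J - 1))"
        by (simp add: infinity B_def l_def J_def Let_def)
      \<comment> \<open>All \<open>J\<close> digits are correct, so the remaining order is taken
        modulo \<open>l ^ 0\<close> and equals 1.\<close>
      have "card (cyc_coset q (B * l ^ J) (?g (Suc k))) = \<theta> * ord (l ^ (J - J)) Q"
      proof (rule step)
        show "[?g (Suc k) = ?g k] (mod int B)" unfolding g' by (simp add: cong_iff_dvd_diff)
        show "int l ^ J dvd ?g (Suc k)"
          unfolding g' by (rule power_dvd_add_phi_trunc[OF copBl l0 J])
      qed auto
      thus ?thesis by (simp add: infinity \<theta>_def)
    next
      case (enat i)
      have i: "i < J" using m_mem J by (auto simp: enat)
      \<comment> \<open>\<open>a'\<close> and \<open>x\<close> are left free to cover both branches: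
        \<open>a (Suc k)\<close> and \<open>t (Suc k)\<close> in general, 1 and
        \<open>2 * t (Suc k)\<close> in the exceptional case, where the power of 2 at
        \<open>t\<close> is one higher.\<close>
      have tau_step: "card (cyc_coset q (B * l ^ J) (?g (Suc k))) = \<theta> * ord (l ^ (J - i)) Q"
        if a': "a' \<in> {1..rk q l \<theta>}"
          and g': "?g (Suc k) = ?g k + int (B * (U q R B l (?g k) i a' + l ^ Suc i * x))" for a' x
      proof -
        have "\<not> l dvd q ^ \<theta> - 1 \<Longrightarrow> full_reps l (q ^ \<theta>) (R B l (?g k))"
          using R[OF B(2,1) l(1) ldB l(2), of "?g k"] by (simp add: \<theta>)
        then obtain u where u: "u < l" "u \<noteq> phi_digit B l (?g k) i"
          "U q R B l (?g k) i a' = (\<Sum>h<i. phi_digit B l (?g k) h * l ^ h) + u * l ^ i"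
          using U_eq_wrong_digit[of l B q "?g k" a' R i] l(1) copBl ldQ a'
          unfolding \<theta> Q_def by blast
        note digit = wrong_phi_digit[OF l(1) copBl u(1,2), of x, folded u(3), folded g']
        show ?thesis
        proof (rule step[OF _ _ digit])
          show "[?g (Suc k) = ?g k] (mod int B)" unfolding g' by (simp add: cong_iff_dvd_diff)
        qed (use i in simp)
      qed
      show ?thesis
      proof (cases "k = 0 \<and> exceptional q \<tau> P")
        case True
        have l2: "l = 2" and Q3: "[Q = 3] (mod 4)"
          using True by (auto simp: exceptional_def l_def Q_def \<theta>_def)
        \<comment> \<open>Makes 1 an admissible index for \<open>U\<close>.\<close>
        have "rk q 2 \<theta> > 0" using rk_pos[of 2 q \<theta>] ldQ l2 by (simp add: Q_def)
        hence "card (cyc_coset q (B * l ^ J) (?g (Suc k))) = \<theta> * ord (l ^ (J - i)) Q"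
          using True enat l2 assms(11)
          by (intro tau_step[of 1 "2 * t (Suc k)"]) (simp_all add: B_def Let_def)
        moreover have "?tau (Suc k)
            = (if i = J - 1 then \<theta> else 2 ^ max 1 (J - i - multiplicity 2 (Q + 1)) * \<theta>)"
          using True enat by (simp add: Let_def J_def v1_exc_def Q_def \<theta>_def)
        \<comment> \<open>Here the modulus is 2, where an odd number has order 1; the formula for 3
          modulo 4 starts at exponent 2.\<close>
        moreover have "ord (2 ^ (J - i)) Q = 1" if "i = J - 1"
        proof -
          have "J - i = 1" using that J by simp
          moreover have "[Q = 1] (mod 2)" using ldQ l2 by (simp add: cong_def mod_2_eq_odd)
          ultimately show ?thesis by (simp add: ord_eq_Suc_0_iff)
        qed
        moreover have "ord (2 ^ (J - i)) Q = 2 ^ max 1 (J - i - multiplicity 2 (Q + 1))" if "i \<noteq> J - 1"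
          using that i by (intro ord_two_power_3_mod_4[OF Q3]) auto
        ultimately show ?thesis using l2 by auto
      next
        case False
        \<comment> \<open>The primes increase, so 2 can only be the first one; outside the
          exceptional case the odd number \<open>Q\<close> is then 1 modulo 4, as
          \<open>ord_prime_power\<close> requires.\<close>
        have Qmod4: "[Q = 1] (mod 4)" if "l = 2"
        proof -
          have "k = 0"
          proof (rule ccontr)
            assume "k \<noteq> 0"
            hence "P 1 < l" "prime (P 1)"
              unfolding l_def using P_less[of 1 "Suc k"] prime_P[of 1] mem by auto
            thus False using that prime_ge_2_nat[of "P 1"] by simp
          qed
          hence "\<not> [Q = 3] (mod 4)"
            using False that by (auto simp: exceptional_def l_def Q_def \<theta>_def)
          hence "Q mod 4 \<noteq> 3" by (simp add: cong_def)
          moreover have "odd Q" using ldQ that by simp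
          ultimately have "Q mod 4 = 1" by presburger
          thus ?thesis by (simp add: cong_def)
        qed
        have a: "a (Suc k) \<in> {1..rk q l \<theta>}"
          using a_range[OF mem enat] False by (simp add: l_def \<theta>_def)
        have "?g (Suc k) = ?g k + int (B * (U q R B l (?g k) i (a (Suc k)) + l ^ Suc i * t (Suc k)))"
          using False assms(11) by (auto simp: enat B_def l_def Let_def)
        from tau_step[OF a this]
        have "card (cyc_coset q (B * l ^ J) (?g (Suc k))) = \<theta> * ord (l ^ (J - i)) Q" .
        also have "ord (l ^ (J - i)) Q = ord l Q * l ^ (J - i - vk q l \<theta>)"
          using ord_prime_power[OF l(1) Q1 ldQ Qmod4, of "J - i"] i
            vk_altdef[OF l(1) ldQ[unfolded Q_def]] by (simp add: Q_def)
        also have "\<theta> * \<dots> = ?tau (Suc k)"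
          using False div_rk[OF l(1) ldQ[unfolded Q_def]]
          by (auto simp: enat Let_def l_def J_def Q_def \<theta>_def)
        finally show ?thesis .
      qed
    qed
    moreover have "coprime (B * l ^ J) q" using B(1) l(3) by simp
    moreover have "B * l ^ J > 0" using B(2) l0 by simp
    ultimately show ?case by (simp only: BS)
  qed
  moreover have "Bk n P j (Suc s) = n * n'"
    unfolding Bk_def assms(10) by (simp add: atLeastLessThanSuc_atLeastAtMost)
  ultimately show ?thesis by (metis order_refl)
qed

end
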